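(* Let $m,n$ be positive integers, let $c_j\ge0$ and $d_{ij}\ge0$ ($i\in[m]$, $j\in[n]$) be real numbers, and let $\chi^L$ be the mixed-binary set defined in the context. Let $I\subseteq[m]$ and $J\subseteq[n]$. Suppose the following conditions are satisfied: $$\sum_{j\in J}c_j>\sum_{i\in I}\max_{j\in J}d_{ij},\qquad \max_{j\in[n]}d_{ij}=\max_{j\in J}d_{ij}\quad\text{for all } i\in I,$$ $$\sum_{j\in J\setminus\{j_0\}}c_j<\sum_{i\in I}\max_{j\in J\setminus\{j_0\}}d_{ij}\quad\text{for all } j_0\in J.$$ Then the following inequality defines a facet of $\mathrm{conv}(\chi^L)$: $$\sum_{i\in I}\sum_{j\in J}x_{ij}+\sum_{j\in J}\Big(\sum_{j'\in J\setminus\{j\}}c_{j'}-\sum_{i\in I}\max_{j'\in J}d_{ij'}\Big)y_j\le(|J|-1)\Big(\sum_{j\in J}c_j-\sum_{i\in I}\max_{j'\in J}d_{ij'}\Big).$$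
   Context: Notation: $[k]=\{1,\ldots,k\}$; a maximum over the empty set is taken to be $0$. The number $c_j$ is the capacity of a service center at location $j\in[n]$, and $d_{ij}$ is the demand attracted from customer site $i\in[m]$ by a service center at $j$. The set $\chi^L\subset\mathbb{R}^{mn}\times\mathbb{R}^n\times\mathbb{R}^{mn}$ consists of all $[x,y,q]$, with $x=(x_{ij})$, $y=(y_j)$, $q=(q_{ij})$, $i\in[m]$, $j\in[n]$, satisfying $\sum_{i=1}^m x_{ij}\le c_jy_j$ for all $j\in[n]$; $\sum_{j=1}^n x_{ij}\le\sum_{j=1}^n d_{ij}q_{ij}$ for all $i\in[m]$; $\sum_{j=1}^n q_{ij}\le1$ for all $i\in[m]$; $q_{ij}\le y_j$ for all $i\in[m]$, $j\in[n]$; $x_{ij}\ge0$, $q_{ij}\ge0$, $y_j\in\{0,1\}$ for all $i\in[m]$, $j\in[n]$. An inequality defines a facet of a polytope $P$ if it is valid for $P$ (satisfied by all points of $P$) and the set of points of $P$ satisfying it with equality has dimension $\dim P-1$. *)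

theory Defs
  imports "HOL-Analysis.Analysis"
begin

text \<open>The number of customer sites and of locations are the cardinalities of the finite
  types \<open>'m\<close> and \<open>'n\<close>; the entry \<open>x $ i $ j\<close> stands for \<open>x\<^sub>i\<^sub>j\<close>.\<close>

definition chi_L :: "('n::finite \<Rightarrow> real) \<Rightarrow> ('m::finite \<Rightarrow> 'n \<Rightarrow> real)
    \<Rightarrow> ((real ^ 'n ^ 'm) \<times> (real ^ 'n) \<times> (real ^ 'n ^ 'm)) set" where
  "chi_L c d = {(x, y, q).
     (\<forall>j. (\<Sum>i\<in>UNIV. x $ i $ j) \<le> c j * y $ j) \<and>
     (\<forall>i. (\<Sum>j\<in>UNIV. x $ i $ j) \<le> (\<Sum>j\<in>UNIV. d i j * q $ i $ j)) \<and>
     (\<forall>i. (\<Sum>j\<in>UNIV. q $ i $ j) \<le> 1) \<and>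
     (\<forall>i j. q $ i $ j \<le> y $ j) \<and>
     (\<forall>i j. x $ i $ j \<ge> 0) \<and>
     (\<forall>i j. q $ i $ j \<ge> 0) \<and>
     (\<forall>j. y $ j \<in> {0, 1})}"

definition max_over :: "'a set \<Rightarrow> ('a \<Rightarrow> real) \<Rightarrow> real" where
  "max_over A f = (if A = {} then 0 else Max (f ` A))"

text \<open>The inequality \<open>f z \<le> b\<close>, for a linear functional \<open>f\<close>, defines a facet of \<open>P\<close>.
  Unlike \<^const>\<open>facet_of\<close>, this is a property of the inequality rather than of a face.\<close>

definition defines_facet :: "('a::euclidean_space \<Rightarrow> real) \<Rightarrow> real \<Rightarrow> 'a set \<Rightarrow> bool" where
  "defines_facet f b P \<longleftrightarrow>
     linear f \<and> (\<forall>z\<in>P. f z \<le> b) \<and> aff_dim {z\<in>P. f z = b} = aff_dim P - 1"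

end

theory Submission
  imports Defs
begin

text \<open>Write \<open>C\<close> for the total capacity over \<open>J\<close>, \<open>D\<close> for the total maximal demand of \<open>I\<close> and
  \<open>k = |J|\<close>. The right-hand side \<open>(k - 1) (C - D)\<close> is positive, so \<open>0\<close> lies in the hull but not in
  the affine hull of its tight part, and it is enough that the tight points of \<open>\<chi>\<^sup>L\<close>
  linearly span \<open>\<chi>\<^sup>L\<close>. Two kinds of points are tight: all of \<open>J\<close> is open and the demand \<open>D\<close> is
  met, with capacity to spare at every \<open>j\<close> with \<open>c j > 0\<close>; or a single \<open>j0\<close> in \<open>J\<close> is closed and
  the other centers work at capacity, with demand to spare. Perturbing them within the slack gives
  all unit vectors except those of \<open>x i j\<close> and \<open>y j\<close> with \<open>i \<in> I\<close>, \<open>j \<in> J\<close>. Modulo the span,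
  the remaining unit vectors of the \<open>x i j\<close> agree, say with \<open>v\<close>: exchanges between two centers are possible
  when all are open, and exchanges between two customers when one center is closed. Averaging the
  shortage hypothesis over \<open>j0\<close> yields a customer that keeps positive demand whichever center is
  closed, and every other customer can be exchanged with it. Then \<open>D v + \<Sum>j\<in>J. y j\<close> and
  \<open>(D - C + c j) v + y j\<close> are in the span, hence so is \<open>(k - 1) (C - D) v\<close>.\<close>

section \<open>Maxima over finite sets\<close>

lemma max_over_ge: "j \<in> A \<Longrightarrow> f j \<le> max_over A f" for A :: "'a::finite set"
  by (auto simp: max_over_def)

lemma max_over_attained:
  fixes A :: "'a::finite set"
  assumes "A \<noteq> {}"
  obtains j where "j \<in> A" "max_over A f = f j"
proof -
  have "max_over A f \<in> f ` A"
    using Max_in[of "f ` A"] assms by (simp add: max_over_def)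
  then show thesis using that by blast
qed

lemma max_over_nonneg:
  fixes A :: "'a::finite set"
  assumes "\<And>j. 0 \<le> f j"
  shows "0 \<le> max_over A f"
proof (cases "A = {}")
  case False
  then obtain j where "max_over A f = f j" by (rule max_over_attained)
  with assms show ?thesis by simp
qed (simp add: max_over_def)

text \<open>Nonnegativity of \<open>f\<close> makes the default value 0 for empty \<open>A\<close> a
  lower bound as well.\<close>

lemma max_over_mono:
  fixes A :: "'a::finite set"
  assumes "A \<subseteq> B" "\<And>j. 0 \<le> f j"
  shows "max_over A f \<le> max_over B f"
proof (cases "A = {}")
  case True
  with max_over_nonneg[of f B] assms(2) show ?thesis by (simp add: max_over_def)
next
  case False
  then obtain j where "j \<in> A" "max_over A f = f j" by (rule max_over_attained)
  with assms(1) max_over_ge[of j B f] show ?thesis by auto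
qed

section \<open>Coordinates and unit vectors\<close>

text \<open>Parametrising the product space by plain functions lets sums, differences and multiples
  be computed entrywise.\<close>

definition point ::
    "('m \<Rightarrow> 'n \<Rightarrow> real) \<Rightarrow> ('n \<Rightarrow> real) \<Rightarrow> ('m \<Rightarrow> 'n \<Rightarrow> real)
      \<Rightarrow> (real ^ 'n::finite ^ 'm::finite) \<times> (real ^ 'n) \<times> (real ^ 'n ^ 'm)" where
  "point X Y Q = ((\<chi> i j. X i j), (\<chi> j. Y j), (\<chi> i j. Q i j))"

lemma point_cases: obtains X Y Q where "z = point X Y Q"
proof -
  obtain x y q where "z = (x, y, q)" by (cases z) auto
  then have "z = point (\<lambda>i j. x $ i $ j) (\<lambda>j. y $ j) (\<lambda>i j. q $ i $ j)"
    by (simp add: point_def vec_eq_iff)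
  then show thesis by (rule that)
qed

lemma point_add:
  "point X Y Q + point X' Y' Q'
    = point (\<lambda>i j. X i j + X' i j) (\<lambda>j. Y j + Y' j) (\<lambda>i j. Q i j + Q' i j)"
  by (simp add: point_def vec_eq_iff)

lemma point_diff:
  "point X Y Q - point X' Y' Q'
    = point (\<lambda>i j. X i j - X' i j) (\<lambda>j. Y j - Y' j) (\<lambda>i j. Q i j - Q' i j)"
  by (simp add: point_def vec_eq_iff)

lemma point_scaleR:
  "r *\<^sub>R point X Y Q = point (\<lambda>i j. r * X i j) (\<lambda>j. r * Y j) (\<lambda>i j. r * Q i j)"
  by (simp add: point_def vec_eq_iff)

lemma point_zero: "point (\<lambda>_ _. 0) (\<lambda>_. 0) (\<lambda>_ _. 0) = 0"
  by (simp add: point_def vec_eq_iff zero_prod_def)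

definition unit :: "'a \<Rightarrow> 'a \<Rightarrow> real" where "unit a i = of_bool (i = a)"

definition unit2 :: "'m \<Rightarrow> 'n \<Rightarrow> 'm \<Rightarrow> 'n \<Rightarrow> real" where "unit2 a b i j = unit a i * unit b j"

lemma sum_unit: "(\<Sum>i\<in>A. unit a i) = of_bool (a \<in> A)" for A :: "'a::finite set"
  by (simp add: unit_def of_bool_def)

lemma sum_mult_unit: "(\<Sum>i\<in>A. f i * unit a i) = f a * of_bool (a \<in> A)" for A :: "'a::finite set"
  by (simp add: unit_def of_bool_def if_distrib cong: if_cong)

lemma sum_unit2_row: "(\<Sum>j\<in>B. unit2 a b i j) = unit a i * of_bool (b \<in> B)" for B :: "'n::finite set"
  by (simp add: unit2_def sum_unit flip: sum_distrib_left)

lemma sum_unit2_column: "(\<Sum>i\<in>A. unit2 a b i j) = unit b j * of_bool (a \<in> A)"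
  for A :: "'m::finite set"
  by (simp add: unit2_def sum_unit mult.commute flip: sum_distrib_left)

abbreviation e_x :: "'m \<Rightarrow> 'n \<Rightarrow> (real ^ 'n::finite ^ 'm::finite) \<times> (real ^ 'n) \<times> (real ^ 'n ^ 'm)"
  where "e_x i j \<equiv> point (unit2 i j) (\<lambda>_. 0) (\<lambda>_ _. 0)"

abbreviation e_y :: "'n \<Rightarrow> (real ^ 'n::finite ^ 'm::finite) \<times> (real ^ 'n) \<times> (real ^ 'n ^ 'm)"
  where "e_y j \<equiv> point (\<lambda>_ _. 0) (unit j) (\<lambda>_ _. 0)"

abbreviation e_q :: "'m \<Rightarrow> 'n \<Rightarrow> (real ^ 'n::finite ^ 'm::finite) \<times> (real ^ 'n) \<times> (real ^ 'n ^ 'm)"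
  where "e_q i j \<equiv> point (\<lambda>_ _. 0) (\<lambda>_. 0) (unit2 i j)"

lemma point_sum:
  "point (\<lambda>i j. \<Sum>k\<in>K. X k i j) (\<lambda>j. \<Sum>k\<in>K. Y k j) (\<lambda>i j. \<Sum>k\<in>K. Q k i j)
    = (\<Sum>k\<in>K. point (X k) (Y k) (Q k))"
proof (induction K rule: infinite_finite_induct)
  case (insert k K)
  then show ?case by (simp add: point_add[symmetric])
qed (simp_all add: point_zero)

lemma sum_unit_expand: "(\<Sum>a\<in>UNIV. Y a * unit a j) = Y (j::'n::finite)"
  by (simp add: unit_def of_bool_def if_distrib cong: if_cong)

lemma sum_unit2_expand:
  "(\<Sum>a\<in>UNIV. \<Sum>b\<in>UNIV. X a b * unit2 a b i j) = X (i::'m::finite) (j::'n::finite)"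
proof -
  have "(\<Sum>b\<in>UNIV. X a b * unit2 a b i j) = X a j * unit a i" for a
    using sum_unit_expand[of "\<lambda>b. X a b * unit a i" j] by (simp add: unit2_def mult.assoc)
  then show ?thesis by (simp add: sum_unit_expand)
qed

lemma point_expand_x:
  "point X (\<lambda>_. 0) (\<lambda>_ _. 0) = (\<Sum>i\<in>UNIV. \<Sum>j\<in>UNIV. X i j *\<^sub>R e_x i j)"
  unfolding point_scaleR point_sum[symmetric] by (simp add: sum_unit2_expand)

lemma point_expand_y:
  "point (\<lambda>_ _. 0) Y (\<lambda>_ _. 0) = (\<Sum>j\<in>UNIV. Y j *\<^sub>R e_y j)"
  unfolding point_scaleR point_sum[symmetric] by (simp add: sum_unit_expand)

lemma point_expand_q:
  "point (\<lambda>_ _. 0) (\<lambda>_. 0) Q = (\<Sum>i\<in>UNIV. \<Sum>j\<in>UNIV. Q i j *\<^sub>R e_q i j)"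
  unfolding point_scaleR point_sum[symmetric] by (simp add: sum_unit2_expand)

lemma point_split:
  "point X Y Q = point X (\<lambda>_. 0) (\<lambda>_ _. 0) + point (\<lambda>_ _. 0) Y (\<lambda>_ _. 0)
    + point (\<lambda>_ _. 0) (\<lambda>_. 0) Q"
  by (simp add: point_add)

lemma point_mem_chi_L:
  "point X Y Q \<in> chi_L c d \<longleftrightarrow>
     (\<forall>j. (\<Sum>i\<in>UNIV. X i j) \<le> c j * Y j) \<and>
     (\<forall>i. (\<Sum>j\<in>UNIV. X i j) \<le> (\<Sum>j\<in>UNIV. d i j * Q i j)) \<and>
     (\<forall>i. (\<Sum>j\<in>UNIV. Q i j) \<le> 1) \<and>
     (\<forall>i j. Q i j \<le> Y j) \<and>
     (\<forall>i j. X i j \<ge> 0) \<and> (\<forall>i j. Q i j \<ge> 0) \<and> (\<forall>j. Y j \<in> {0, 1})"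
  by (simp add: chi_L_def point_def)

lemma sum_if_mem_left: "(\<Sum>j\<in>UNIV. if P \<and> j \<in> A then f j else 0) = (if P then \<Sum>j\<in>A. f j else 0)"
  for f :: "'z::finite \<Rightarrow> real"
  by (simp add: sum.If_cases)

lemma sum_if_mem_right: "(\<Sum>j\<in>UNIV. if j \<in> A \<and> P then f j else 0) = (if P then \<Sum>j\<in>A. f j else 0)"
  for f :: "'z::finite \<Rightarrow> real"
  by (simp add: sum.If_cases)

section \<open>Numerical consequences of surplus and shortage\<close>

locale service_network =
  fixes c :: "'n::finite \<Rightarrow> real"
    and d :: "'m::finite \<Rightarrow> 'n \<Rightarrow> real"
    and I :: "'m set" and J :: "'n set"
  assumes c_nonneg: "c j \<ge> 0" and d_nonneg: "d i j \<ge> 0"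
    and excess: "(\<Sum>j\<in>J. c j) > (\<Sum>i\<in>I. max_over J (d i))"
    and max_over_UNIV: "i \<in> I \<Longrightarrow> max_over UNIV (d i) = max_over J (d i)"
    and shortage: "j0 \<in> J \<Longrightarrow>
           (\<Sum>j\<in>J - {j0}. c j) < (\<Sum>i\<in>I. max_over (J - {j0}) (d i))"
begin

definition capacity :: real where "capacity = (\<Sum>j\<in>J. c j)"

definition demand :: real where "demand = (\<Sum>i\<in>I. max_over J (d i))"

definition demand_without :: "'n \<Rightarrow> real" where
  "demand_without j0 = (\<Sum>i\<in>I. max_over (J - {j0}) (d i))"

text \<open>Kept literally as in the theorem; \<open>lhs_point\<close> is the form used in
  calculations.\<close>

definition lhs :: "(real ^ 'n ^ 'm) \<times> (real ^ 'n) \<times> (real ^ 'n ^ 'm) \<Rightarrow> real" where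
  "lhs = (\<lambda>(x, y, q). (\<Sum>i\<in>I. \<Sum>j\<in>J. x $ i $ j) +
     (\<Sum>j\<in>J. ((\<Sum>j'\<in>J - {j}. c j') - (\<Sum>i\<in>I. max_over J (d i))) * y $ j))"

definition rhs :: real where
  "rhs = (real (card J) - 1) * ((\<Sum>j\<in>J. c j) - (\<Sum>i\<in>I. max_over J (d i)))"

definition tight :: "((real ^ 'n ^ 'm) \<times> (real ^ 'n) \<times> (real ^ 'n ^ 'm)) set" where
  "tight = {z \<in> chi_L c d. lhs z = rhs}"

lemma max_demand_nonneg: "0 \<le> max_over A (d i)"
  by (intro max_over_nonneg d_nonneg)

lemma capacity_remove: "j \<in> J \<Longrightarrow> (\<Sum>j'\<in>J - {j}. c j') = capacity - c j"
  by (simp add: capacity_def sum_diff1)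

lemma demand_nonneg: "0 \<le> demand"
  unfolding demand_def by (intro sum_nonneg max_demand_nonneg)

lemma demand_less: "demand < capacity"
  using excess by (simp add: demand_def capacity_def)

lemma capacity_pos: "0 < capacity"
  using demand_nonneg demand_less by simp

lemma J_nonempty: "J \<noteq> {}"
  using capacity_pos by (auto simp: capacity_def)

lemma capacity_less_demand_without: "j0 \<in> J \<Longrightarrow> capacity - c j0 < demand_without j0"
  using shortage by (simp add: demand_without_def capacity_remove)

lemma c_le_capacity: "j \<in> J \<Longrightarrow> c j \<le> capacity"
  unfolding capacity_def by (intro member_le_sum c_nonneg) auto

lemma demand_without_pos: "j0 \<in> J \<Longrightarrow> 0 < demand_without j0"
  using capacity_less_demand_without[of j0] c_le_capacity[of j0] by simp

lemma demand_without_le: "demand_without j0 \<le> demand"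
  unfolding demand_def demand_without_def by (intro sum_mono max_over_mono d_nonneg) auto

text \<open>Closing \<open>j\<close> turns the surplus over \<open>J\<close> into a shortage, so
  \<open>j\<close> must contribute capacity.\<close>

lemma c_pos: "j \<in> J \<Longrightarrow> 0 < c j"
  using capacity_less_demand_without[of j] demand_without_le[of j] demand_less by simp

text \<open>Supplies a center to close that differs from a given one. For a singleton
  \<open>J\<close> the shortage hypothesis would read \<open>0 < 0\<close>, since the maximum over
  the empty set is 0.\<close>

lemma obtain_other: obtains j0 where "j0 \<in> J" "j0 \<noteq> j"
proof -
  have "J \<noteq> {j}"
  proof
    assume "J = {j}"
    then have "J - {j} = {}" by simp
    then have "demand_without j = 0" by (simp only: demand_without_def max_over_def) simp
    with demand_without_pos[of j] \<open>J = {j}\<close> show False by simp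
  qed
  then show thesis using J_nonempty that by blast
qed

lemma card_J: "2 \<le> card J"
proof -
  obtain j where "j \<in> J" using J_nonempty by blast
  obtain j0 where "j0 \<in> J" "j0 \<noteq> j" by (rule obtain_other)
  with \<open>j \<in> J\<close> have "card {j, j0} \<le> card J" by (intro card_mono) auto
  then show ?thesis using \<open>j0 \<noteq> j\<close> by simp
qed

lemma rhs_pos: "0 < rhs"
  using card_J demand_less by (simp add: rhs_def demand_def capacity_def)

lemma lhs_point:
  "lhs (point X Y Q)
    = (\<Sum>i\<in>I. \<Sum>j\<in>J. X i j) + (\<Sum>j\<in>J. (capacity - demand - c j) * Y j)"
  by (simp add: lhs_def point_def capacity_remove demand_def[symmetric] algebra_simps)

lemma rhs_eq: "rhs = (real (card J) - 1) * (capacity - demand)"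
  by (simp add: rhs_def capacity_def demand_def)

lemma sum_weights:
  "(\<Sum>j\<in>J. capacity - demand - c j) = real (card J) * (capacity - demand) - capacity"
  by (simp add: sum_subtractf right_diff_distrib flip: capacity_def)

section \<open>Validity of the inequality\<close>

lemma linear_lhs: "linear lhs"
proof (rule linearI)
  fix z z' :: "(real ^ 'n ^ 'm) \<times> (real ^ 'n) \<times> (real ^ 'n ^ 'm)" and r :: real
  obtain X Y Q where z: "z = point X Y Q" by (rule point_cases)
  obtain X' Y' Q' where z': "z' = point X' Y' Q'" by (rule point_cases)
  show "lhs (z + z') = lhs z + lhs z'"
    by (simp add: z z' point_add lhs_point sum.distrib distrib_left)
  show "lhs (r *\<^sub>R z) = r *\<^sub>R lhs z"
    by (simp add: z point_scaleR lhs_point sum_distrib_left algebra_simps)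
qed

text \<open>If all of \<open>J\<close> is open, the shipments are bounded by the demand. Otherwise
  they are bounded by the capacities of the open centers, of which at most \<open>card J - 1\<close>
  lie in \<open>J\<close>.\<close>

lemma lhs_le_rhs:
  assumes "z \<in> chi_L c d" shows "lhs z \<le> rhs"
proof -
  obtain X Y Q where z: "z = point X Y Q" by (rule point_cases)
  have col: "(\<Sum>i\<in>UNIV. X i j) \<le> c j * Y j" and row: "(\<Sum>j\<in>UNIV. X i j) \<le> (\<Sum>j\<in>UNIV. d i j * Q i j)"
    and Q1: "(\<Sum>j\<in>UNIV. Q i j) \<le> 1" and X0: "X i j \<ge> 0" and Q0: "Q i j \<ge> 0"
    and Y: "Y j = 0 \<or> Y j = 1" for i j
    using assms unfolding z point_mem_chi_L by auto
  show ?thesis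
  proof (cases "\<forall>j\<in>J. Y j = 1")
    case True
    have "(\<Sum>j\<in>J. X i j) \<le> max_over J (d i)" if "i \<in> I" for i
    proof -
      have "(\<Sum>j\<in>J. X i j) \<le> (\<Sum>j\<in>UNIV. X i j)" by (intro sum_mono2) (auto simp: X0)
      \<comment> \<open>Customer \<open>i\<close> may be assigned to centers outside
        \<open>J\<close>, but those offer no more than the maximum over \<open>J\<close>.\<close>
      also have "\<dots> \<le> (\<Sum>j\<in>UNIV. max_over J (d i) * Q i j)"
        using max_over_ge[of _ UNIV "d i"] max_over_UNIV[OF that]
        by (intro order_trans[OF row] sum_mono mult_right_mono Q0) auto
      also have "\<dots> \<le> max_over J (d i) * 1"
        unfolding sum_distrib_left[symmetric]
        by (intro mult_left_mono Q1 max_demand_nonneg)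
      finally show ?thesis by simp
    qed
    then have "(\<Sum>i\<in>I. \<Sum>j\<in>J. X i j) \<le> demand"
      unfolding demand_def by (rule sum_mono)
    moreover have "(\<Sum>j\<in>J. (capacity - demand - c j) * Y j) = (\<Sum>j\<in>J. capacity - demand - c j)"
      using True by simp
    ultimately have "lhs z \<le> demand + (real (card J) * (capacity - demand) - capacity)"
      by (simp add: z lhs_point sum_weights)
    then show ?thesis by (simp add: rhs_eq algebra_simps)
  next
    case False
    then obtain j0 where j0: "j0 \<in> J" "Y j0 = 0" using Y by blast
    have "(\<Sum>i\<in>I. \<Sum>j\<in>J. X i j) = (\<Sum>j\<in>J. \<Sum>i\<in>I. X i j)" by (rule sum.swap)
    also have "\<dots> \<le> (\<Sum>j\<in>J. \<Sum>i\<in>UNIV. X i j)"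
      by (intro sum_mono sum_mono2) (auto simp: X0)
    also have "\<dots> \<le> (\<Sum>j\<in>J. c j * Y j)" by (intro sum_mono col)
    \<comment> \<open>The bound \<open>c j * Y j\<close> cancels the \<open>- c j\<close> in the
      coefficient of \<open>Y j\<close>, so every open center gets the same weight.\<close>
    finally have "lhs z \<le> (capacity - demand) * (\<Sum>j\<in>J. Y j)"
      by (simp add: z lhs_point sum_subtractf left_diff_distrib sum_distrib_left)
    moreover have "(\<Sum>j\<in>J. Y j) \<le> (\<Sum>j\<in>J. 1 - unit j0 j)"
      using j0 Y by (intro sum_mono) (metis (full_types) diff_0_right diff_self of_bool_eq unit_def order_refl zero_le_one)
    then have "(\<Sum>j\<in>J. Y j) \<le> real (card J) - 1"
      using j0 by (simp add: sum_subtractf sum_unit)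
    then have "(capacity - demand) * (\<Sum>j\<in>J. Y j) \<le> (capacity - demand) * (real (card J) - 1)"
      using demand_less by (intro mult_left_mono) auto
    ultimately show ?thesis
      unfolding rhs_eq mult.commute[of _ "capacity - demand"] by (rule order_trans)
  qed
qed

section \<open>Two families of tight points\<close>

text \<open>The equality case with \<open>J\<close> open; the centers outside \<open>J\<close> may
  be open or closed.\<close>

lemma tight_open:
  assumes "point X Y Q \<in> chi_L c d" "\<And>j. j \<in> J \<Longrightarrow> Y j = 1" "(\<Sum>i\<in>I. \<Sum>j\<in>J. X i j) = demand"
  shows "point X Y Q \<in> tight"
proof -
  have "(\<Sum>j\<in>J. (capacity - demand - c j) * Y j) = (\<Sum>j\<in>J. capacity - demand - c j)"
    using assms(2) by simp
  with assms(1,3) show ?thesis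
    by (simp add: tight_def lhs_point rhs_eq sum_weights) (simp add: algebra_simps)
qed

text \<open>The equality case with exactly \<open>j0\<close> closed: the other centers of
  \<open>J\<close> ship their full capacity to \<open>I\<close>.\<close>

lemma tight_closed:
  assumes "point X (\<lambda>j. 1 - unit j0 j) Q \<in> chi_L c d" "j0 \<in> J"
    "(\<Sum>i\<in>I. \<Sum>j\<in>J. X i j) = capacity - c j0"
  shows "point X (\<lambda>j. 1 - unit j0 j) Q \<in> tight"
proof -
  have "(\<Sum>j\<in>J. (capacity - demand - c j) * (1 - unit j0 j))
      = (\<Sum>j\<in>J. capacity - demand - c j) - (capacity - demand - c j0)"
    using assms(2) unfolding right_diff_distrib[of _ 1] sum_subtractf[of _ "\<lambda>j. _ j * unit j0 j"]
    by (simp add: sum_mult_unit)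
  with assms(1,3) show ?thesis
    by (simp add: tight_def lhs_point rhs_eq sum_weights) (simp add: algebra_simps)
qed

text \<open>The shipments are proportional to the maximal demands of the customers and to the
  capacities, so that all slack is spread evenly.\<close>

definition open_plan :: "'m \<Rightarrow> 'n \<Rightarrow> real" where
  "open_plan i j = (if i \<in> I \<and> j \<in> J then c j * max_over J (d i) / capacity else 0)"

definition closed_plan :: "'n \<Rightarrow> 'm \<Rightarrow> 'n \<Rightarrow> real" where
  "closed_plan j0 i j =
    (if i \<in> I \<and> j \<in> J - {j0} then c j * max_over (J - {j0}) (d i) / demand_without j0 else 0)"

text \<open>The fraction of the remaining maximal demand of each customer in \<open>I\<close> that
  \<open>closed_plan\<close> serves. Shortage makes it less than 1.\<close>

definition load :: "'n \<Rightarrow> real" where "load j0 = (capacity - c j0) / demand_without j0"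

lemma open_plan_nonneg: "0 \<le> open_plan i j"
  using capacity_pos c_nonneg max_demand_nonneg by (simp add: open_plan_def)

lemma closed_plan_nonneg: "j0 \<in> J \<Longrightarrow> 0 \<le> closed_plan j0 i j"
  using demand_without_pos[of j0] c_nonneg max_demand_nonneg by (simp add: closed_plan_def)

lemma open_plan_row: "(\<Sum>j\<in>UNIV. open_plan i j) = (if i \<in> I then max_over J (d i) else 0)"
  using capacity_pos
  by (simp add: open_plan_def sum_if_mem_left flip: sum_distrib_right sum_divide_distrib capacity_def)

lemma open_plan_column:
  "(\<Sum>i\<in>UNIV. open_plan i j) = (if j \<in> J then c j * demand / capacity else 0)"
  by (simp add: open_plan_def sum_if_mem_right demand_def flip: sum_distrib_left sum_divide_distrib)

lemma open_plan_total: "(\<Sum>i\<in>I. \<Sum>j\<in>J. open_plan i j) = demand"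
proof -
  have "(\<Sum>j\<in>J. open_plan i j) = (\<Sum>j\<in>UNIV. open_plan i j)" for i
    by (intro sum.mono_neutral_left) (auto simp: open_plan_def)
  then show ?thesis by (simp add: open_plan_row demand_def)
qed

lemma closed_plan_row:
  assumes "j0 \<in> J"
  shows "(\<Sum>j\<in>UNIV. closed_plan j0 i j)
    = (if i \<in> I then load j0 * max_over (J - {j0}) (d i) else 0)"
  using assms unfolding closed_plan_def sum_if_mem_left
  by (simp add: load_def capacity_remove flip: sum_distrib_right sum_divide_distrib)

lemma closed_plan_column:
  assumes "j0 \<in> J"
  shows "(\<Sum>i\<in>UNIV. closed_plan j0 i j) = (if j \<in> J - {j0} then c j else 0)"
  using demand_without_pos[OF assms] unfolding closed_plan_def sum_if_mem_right
  by (simp flip: sum_distrib_left sum_divide_distrib demand_without_def)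

lemma closed_plan_total:
  assumes "j0 \<in> J"
  shows "(\<Sum>i\<in>I. \<Sum>j\<in>J. closed_plan j0 i j) = capacity - c j0"
proof -
  have "(\<Sum>i\<in>I. \<Sum>j\<in>J. closed_plan j0 i j) = (\<Sum>j\<in>J. \<Sum>i\<in>I. closed_plan j0 i j)"
    by (rule sum.swap)
  also have "\<dots> = (\<Sum>j\<in>J - {j0}. \<Sum>i\<in>UNIV. closed_plan j0 i j)"
    by (intro sum.mono_neutral_cong_right ballI sum.mono_neutral_left) (auto simp: closed_plan_def)
  also have "\<dots> = (\<Sum>j\<in>J - {j0}. c j)"
    by (intro sum.cong) (simp_all add: closed_plan_column[OF assms])
  finally show ?thesis using assms by (simp add: capacity_remove)
qed

lemma load_bounds: assumes "j0 \<in> J" shows "0 \<le> load j0" "load j0 < 1"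
  using demand_without_pos[OF assms] capacity_less_demand_without[OF assms] c_le_capacity[OF assms]
  by (simp_all add: load_def)

text \<open>For \<open>i \<in> I\<close> the maximiser is taken in \<open>J\<close>, so it stays
  available even when the centers outside \<open>J\<close> are closed. The equality of the two
  maxima makes this possible.\<close>

definition best_open :: "'m \<Rightarrow> 'n" where
  "best_open i = (SOME j. max_over UNIV (d i) = d i j \<and> (i \<in> I \<longrightarrow> j \<in> J))"

definition best_closed :: "'n \<Rightarrow> 'm \<Rightarrow> 'n" where
  "best_closed j0 i = (SOME j. j \<in> J - {j0} \<and> max_over (J - {j0}) (d i) = d i j)"

lemma best_open: "d i (best_open i) = max_over UNIV (d i)" "i \<in> I \<Longrightarrow> best_open i \<in> J"
proof -
  have "\<exists>j. max_over UNIV (d i) = d i j \<and> (i \<in> I \<longrightarrow> j \<in> J)"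
  proof (cases "i \<in> I")
    case True
    obtain j where "j \<in> J" "max_over J (d i) = d i j"
      using J_nonempty by (rule max_over_attained)
    with max_over_UNIV[OF True] show ?thesis by auto
  next
    case False
    obtain j where "max_over UNIV (d i) = d i j"
      using UNIV_not_empty by (rule max_over_attained)
    with False show ?thesis by auto
  qed
  from someI_ex[OF this]
  show "d i (best_open i) = max_over UNIV (d i)" "i \<in> I \<Longrightarrow> best_open i \<in> J"
    by (auto simp: best_open_def)
qed

lemma best_closed:
  "best_closed j0 i \<in> J - {j0}" "d i (best_closed j0 i) = max_over (J - {j0}) (d i)"
proof -
  have "J - {j0} \<noteq> {}" using obtain_other[of j0] by blast
  then obtain j where "j \<in> J - {j0}" "max_over (J - {j0}) (d i) = d i j"
    by (rule max_over_attained)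
  then have "\<exists>j. j \<in> J - {j0} \<and> max_over (J - {j0}) (d i) = d i j" by blast
  from someI_ex[OF this]
  show "best_closed j0 i \<in> J - {j0}" "d i (best_closed j0 i) = max_over (J - {j0}) (d i)"
    by (auto simp: best_closed_def)
qed

text \<open>The bounds on \<open>P\<close> are the slack left by \<open>open_plan\<close>: centers
  in \<open>J\<close> use the fraction \<open>demand / capacity\<close>, the others are idle,
  customers in \<open>I\<close> are fully served, and the others receive nothing.\<close>

lemma open_point:
  assumes nonneg: "\<And>i j. 0 \<le> open_plan i j + P i j"
    and column: "\<And>j. (\<Sum>i\<in>UNIV. P i j) \<le> (if j \<in> J then c j * (1 - demand / capacity) else c j)"
    and row: "\<And>i. (\<Sum>j\<in>UNIV. P i j) \<le> (if i \<in> I then 0 else max_over UNIV (d i))"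
    and total: "(\<Sum>i\<in>I. \<Sum>j\<in>J. P i j) = 0"
  shows "point (\<lambda>i j. open_plan i j + P i j) (\<lambda>_. 1) (\<lambda>i. unit (best_open i)) \<in> tight"
proof (rule tight_open)
  have "(\<Sum>i\<in>UNIV. open_plan i j + P i j) \<le> c j" for j
    using column[of j] by (auto simp: sum.distrib open_plan_column algebra_simps split: if_splits)
  moreover have "(\<Sum>j\<in>UNIV. open_plan i j + P i j) \<le> (\<Sum>j\<in>UNIV. d i j * unit (best_open i) j)" for i
    using row[of i] max_over_UNIV[of i]
    by (auto simp: sum.distrib open_plan_row sum_mult_unit best_open split: if_splits)
  ultimately show "point (\<lambda>i j. open_plan i j + P i j) (\<lambda>_. 1) (\<lambda>i. unit (best_open i)) \<in> chi_L c d"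
    using nonneg by (simp add: point_mem_chi_L sum_unit, simp add: unit_def)
  show "(\<Sum>i\<in>I. \<Sum>j\<in>J. open_plan i j + P i j) = demand"
    by (simp add: sum.distrib open_plan_total total)
qed simp

text \<open>The centers of \<open>J\<close> are now full or closed, and the slack is on the side of
  the customers. \<open>Q\<close> is left general so that it can be perturbed too.\<close>

lemma closed_point:
  assumes j0: "j0 \<in> J"
    and nonneg: "\<And>i j. 0 \<le> closed_plan j0 i j + P i j"
    and column: "\<And>j. (\<Sum>i\<in>UNIV. P i j) \<le> (if j \<in> J then 0 else c j)"
    and row: "\<And>i. (\<Sum>j\<in>UNIV. closed_plan j0 i j) + (\<Sum>j\<in>UNIV. P i j) \<le> (\<Sum>j\<in>UNIV. d i j * Q i j)"
    and total: "(\<Sum>i\<in>I. \<Sum>j\<in>J. P i j) = 0"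
    and Q: "\<And>i. (\<Sum>j\<in>UNIV. Q i j) \<le> 1" "\<And>i j. 0 \<le> Q i j" "\<And>i. Q i j0 = 0"
  shows "point (\<lambda>i j. closed_plan j0 i j + P i j) (\<lambda>j. 1 - unit j0 j) Q \<in> tight"
proof (rule tight_closed)
  have Q1: "Q i j \<le> 1" for i j
    using Q(1)[of i] member_le_sum[of j UNIV "Q i"] Q(2) by force
  have "(\<Sum>i\<in>UNIV. closed_plan j0 i j + P i j) \<le> c j * (1 - unit j0 j)" for j
    using column[of j] j0 by (auto simp: sum.distrib closed_plan_column unit_def)
  moreover have "Q i j \<le> 1 - unit j0 j" for i j
    using Q1[of i j] Q(3)[of i] by (auto simp: unit_def)
  ultimately show "point (\<lambda>i j. closed_plan j0 i j + P i j) (\<lambda>j. 1 - unit j0 j) Q \<in> chi_L c d"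
    using nonneg row Q by (simp add: point_mem_chi_L sum.distrib, simp add: unit_def)
  show "(\<Sum>i\<in>I. \<Sum>j\<in>J. closed_plan j0 i j + P i j) = capacity - c j0"
    using j0 by (simp add: sum.distrib closed_plan_total total)
qed (rule j0)

section \<open>Perturbations of tight points\<close>

text \<open>Removes the step size \<open>r\<close> of a perturbation.\<close>

lemma span_tight_quotient:
  assumes "0 < r" "r *\<^sub>R z \<in> span tight" shows "z \<in> span tight"
  using span_scale[OF assms(2), of "inverse r"] assms(1) by simp

lemma spare_capacity: "0 \<le> c j * (1 - demand / capacity)" "0 < c j \<Longrightarrow> 0 < c j * (1 - demand / capacity)"
  "c j * (1 - demand / capacity) \<le> c j"
proof -
  have "0 \<le> demand / capacity" "demand / capacity < 1"
    using demand_nonneg demand_less capacity_pos by simp_all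
  then show "0 \<le> c j * (1 - demand / capacity)" "0 < c j \<Longrightarrow> 0 < c j * (1 - demand / capacity)"
    "c j * (1 - demand / capacity) \<le> c j"
    using c_nonneg[of j] by (simp_all add: mult_left_le)
qed

text \<open>The perturbed and the unperturbed point agree in \<open>y\<close> and \<open>q\<close>,
  so their difference is the perturbation alone.\<close>

lemma open_perturbation:
  assumes nonneg: "\<And>i j. 0 \<le> open_plan i j + P i j"
    and column: "\<And>j. (\<Sum>i\<in>UNIV. P i j) \<le> (if j \<in> J then c j * (1 - demand / capacity) else c j)"
    and row: "\<And>i. (\<Sum>j\<in>UNIV. P i j) \<le> (if i \<in> I then 0 else max_over UNIV (d i))"
    and total: "(\<Sum>i\<in>I. \<Sum>j\<in>J. P i j) = 0"
  shows "point P (\<lambda>_. 0) (\<lambda>_ _. 0) \<in> span tight"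
proof -
  \<comment> \<open>The summand 0 makes this the instance of \<open>open_point\<close> with zero
    perturbation.\<close>
  have "point (\<lambda>i j. open_plan i j + 0) (\<lambda>_. 1) (\<lambda>i. unit (best_open i)) \<in> tight"
    using spare_capacity c_nonneg max_demand_nonneg open_plan_nonneg
    by (intro open_point) auto
  from span_diff[OF span_base[OF open_point[OF assms]] span_base[OF this]]
  show ?thesis by (simp add: point_diff)
qed

text \<open>As with all centers open, a difference of two tight points. A customer in
  \<open>I\<close> has slack \<open>1 - load j0\<close> times its remaining maximal demand.\<close>

lemma closed_perturbation:
  assumes j0: "j0 \<in> J"
    and nonneg: "\<And>i j. 0 \<le> closed_plan j0 i j + P i j"
    and column: "\<And>j. (\<Sum>i\<in>UNIV. P i j) \<le> (if j \<in> J then 0 else c j)"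
    and row: "\<And>i. (\<Sum>j\<in>UNIV. P i j)
      \<le> (if i \<in> I then (1 - load j0) * max_over (J - {j0}) (d i) else 0)"
    and total: "(\<Sum>i\<in>I. \<Sum>j\<in>J. P i j) = 0"
  shows "point P (\<lambda>_. 0) (\<lambda>_ _. 0) \<in> span tight"
proof -
  have *: "point (\<lambda>i j. closed_plan j0 i j + P' i j) (\<lambda>j. 1 - unit j0 j)
      (\<lambda>i. unit (best_closed j0 i)) \<in> tight"
    if "\<And>i j. 0 \<le> closed_plan j0 i j + P' i j"
      "\<And>j. (\<Sum>i\<in>UNIV. P' i j) \<le> (if j \<in> J then 0 else c j)"
      "\<And>i. (\<Sum>j\<in>UNIV. P' i j)
        \<le> (if i \<in> I then (1 - load j0) * max_over (J - {j0}) (d i) else 0)"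
      "(\<Sum>i\<in>I. \<Sum>j\<in>J. P' i j) = 0" for P'
  proof (rule closed_point[OF j0 that(1,2) _ that(4)])
    fix i
    have "0 \<le> max_over (J - {j0}) (d i)" by (intro max_demand_nonneg)
    then show "(\<Sum>j\<in>UNIV. closed_plan j0 i j) + (\<Sum>j\<in>UNIV. P' i j)
        \<le> (\<Sum>j\<in>UNIV. d i j * unit (best_closed j0 i) j)"
      using that(3)[of i]
      by (cases "i \<in> I") (simp_all add: closed_plan_row[OF j0] sum_mult_unit best_closed(2) algebra_simps)
  next
    fix i show "unit (best_closed j0 i) j0 = 0" using best_closed(1)[of j0 i] by (auto simp: unit_def)
  qed (simp_all add: sum_unit, simp add: unit_def)
  have "point (\<lambda>i j. closed_plan j0 i j + 0) (\<lambda>j. 1 - unit j0 j)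
      (\<lambda>i. unit (best_closed j0 i)) \<in> tight"
    using closed_plan_nonneg[OF j0] c_nonneg load_bounds[OF j0] max_demand_nonneg
    by (intro *) auto
  from span_diff[OF span_base[OF *[OF nonneg column row total]] span_base[OF this]]
  show ?thesis by (simp add: point_diff)
qed

section \<open>Unit vectors obtained directly\<close>

text \<open>\<open>open_plan\<close> ships nothing through \<open>j\<close>, so \<open>j\<close> can
  be opened or closed without leaving the tight set.\<close>

lemma e_y_outside_J:
  assumes "j \<notin> J" shows "e_y j \<in> span tight"
proof -
  \<comment> \<open>Customers outside \<open>I\<close> stay unassigned, because their best center
    may be closed.\<close>
  define Q where "Q i j = of_bool (i \<in> I) * unit (best_open i) j" for i j
  have *: "point open_plan Y Q \<in> tight" if Y: "\<And>j. Y j \<in> {0, 1}" "\<And>j. j \<in> J \<Longrightarrow> Y j = 1" for Y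
  proof (rule tight_open)
    have "(\<Sum>i\<in>UNIV. open_plan i j) \<le> c j * Y j" for j
      using Y[of j] spare_capacity(1)[of j] c_nonneg[of j]
      by (auto simp: open_plan_column algebra_simps)
    moreover have "(\<Sum>j\<in>UNIV. open_plan i j) \<le> (\<Sum>j\<in>UNIV. d i j * Q i j)" for i
      using max_over_UNIV[of i]
      by (simp add: open_plan_row Q_def sum_mult_unit best_open)
    moreover have "(\<Sum>j\<in>UNIV. Q i j) \<le> 1" for i
      by (simp add: Q_def sum_unit)
    moreover have "Q i j \<le> Y j" for i j
      using Y[of j] best_open(2)[of i] by (auto simp: Q_def unit_def)
    moreover have "0 \<le> Q i j" for i j by (simp add: Q_def unit_def)
    ultimately show "point open_plan Y Q \<in> chi_L c d"
      using open_plan_nonneg Y by (simp add: point_mem_chi_L)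
  qed (use Y open_plan_total in auto)
  have "point open_plan (\<lambda>k. of_bool (k \<in> J) + unit j k) Q - point open_plan (\<lambda>k. of_bool (k \<in> J)) Q
      \<in> span tight"
    using assms by (intro span_diff span_base *) (auto simp: unit_def)
  then show ?thesis by (simp add: point_diff)
qed

text \<open>With some \<open>j0\<close> other than \<open>j\<close> closed, assigning the fraction
  \<open>load j0\<close> to the best remaining center already supports \<open>closed_plan\<close>.
  The free fraction \<open>1 - load j0\<close> can be put on \<open>j\<close>, which never lowers
  the available demand as \<open>d\<close> is nonnegative.\<close>

lemma e_q_mem: "e_q i j \<in> span tight"
proof -
  obtain j0 where j0: "j0 \<in> J" "j0 \<noteq> j" by (rule obtain_other)
  note load = load_bounds[OF j0(1)]
  define Q where "Q i = (\<lambda>j. load j0 * unit (best_closed j0 i) j)" for i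
  have row_Q: "(\<Sum>j\<in>UNIV. closed_plan j0 i j) \<le> (\<Sum>j\<in>UNIV. d i j * Q i j)" for i
  proof -
    have "(\<Sum>j\<in>UNIV. d i j * Q i j) = load j0 * (\<Sum>j\<in>UNIV. d i j * unit (best_closed j0 i) j)"
      unfolding Q_def sum_distrib_left by (intro sum.cong refl mult.left_commute)
    then show ?thesis
      using load(1) max_demand_nonneg
      by (simp add: sum_mult_unit best_closed(2) closed_plan_row[OF j0(1)])
  qed
  have sum_Q: "(\<Sum>j\<in>UNIV. Q i j) = load j0" for i
    by (simp add: Q_def sum_unit flip: sum_distrib_left)
  have Q0: "0 \<le> Q i j" "Q i j0 = 0" for i j
    using load(1) best_closed(1)[of j0 i] by (auto simp: Q_def unit_def)
  have *: "point (\<lambda>i j. closed_plan j0 i j + 0) (\<lambda>j. 1 - unit j0 j) (\<lambda>i' j'. Q i' j' + r * unit2 i j i' j')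
      \<in> tight" if r: "0 \<le> r" "r \<le> 1 - load j0" for r
  proof (rule closed_point[OF j0(1)])
    fix i'
    have "(\<Sum>j\<in>UNIV. d i' j * Q i' j) \<le> (\<Sum>j'\<in>UNIV. d i' j' * (Q i' j' + r * unit2 i j i' j'))"
      using r(1) by (intro sum_mono mult_left_mono d_nonneg) (simp add: unit2_def unit_def)
    with row_Q[of i']
    show "(\<Sum>j\<in>UNIV. closed_plan j0 i' j) + (\<Sum>j\<in>(UNIV::'n set). 0)
        \<le> (\<Sum>j'\<in>UNIV. d i' j' * (Q i' j' + r * unit2 i j i' j'))" by simp
    have "(\<Sum>j'\<in>UNIV. Q i' j' + r * unit2 i j i' j') = load j0 + r * unit i i'"
      unfolding sum.distrib sum_Q sum_distrib_left[symmetric] sum_unit2_row by simp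
    then show "(\<Sum>j'\<in>UNIV. Q i' j' + r * unit2 i j i' j') \<le> 1"
      using r load by (simp add: unit_def)
    show "Q i' j0 + r * unit2 i j i' j0 = 0" using j0 Q0 by (simp add: unit2_def unit_def)
  qed (use r Q0 closed_plan_nonneg[OF j0(1)] c_nonneg in \<open>auto simp: unit2_def unit_def\<close>)
  have "point (\<lambda>i j. closed_plan j0 i j + 0) (\<lambda>j. 1 - unit j0 j)
        (\<lambda>i' j'. Q i' j' + (1 - load j0) * unit2 i j i' j')
      - point (\<lambda>i j. closed_plan j0 i j + 0) (\<lambda>j. 1 - unit j0 j) (\<lambda>i' j'. Q i' j' + 0 * unit2 i j i' j')
      \<in> span tight"
    using load by (intro span_diff span_base *) auto
  then have "(1 - load j0) *\<^sub>R e_q i j \<in> span tight"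
    unfolding point_diff point_scaleR by simp
  then show ?thesis using load by - (rule span_tight_quotient[of "1 - load j0"], auto)
qed

text \<open>The inequality does not count shipments to \<open>i\<close>, and with all centers open
  both \<open>i\<close> and \<open>j\<close> have room for one.\<close>

lemma e_x_outside_I:
  assumes "i \<notin> I" "0 < c j" "0 < max_over UNIV (d i)"
  shows "e_x i j \<in> span tight"
proof -
  define r where "r = min (c j * (1 - demand / capacity)) (max_over UNIV (d i))"
  have r: "0 < r" "r \<le> c j * (1 - demand / capacity)" "r \<le> max_over UNIV (d i)"
    using assms spare_capacity(2)[of j] by (simp_all add: r_def)
  \<comment> \<open>Needed for \<open>j \<notin> J\<close>, where the slack of the center is all of
    \<open>c j\<close>.\<close>
  have "r \<le> c j"
    using r(2) spare_capacity(3) by (rule order_trans)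
  note r = r this
  have "point (\<lambda>i' j'. r * unit2 i j i' j') (\<lambda>_. 0) (\<lambda>_ _. 0) \<in> span tight"
    using r assms(1) open_plan_nonneg spare_capacity c_nonneg max_demand_nonneg
    by (intro open_perturbation)
      (auto simp: sum_unit2_row sum_unit2_column unit_def unit2_def[abs_def] simp flip: sum_distrib_left
        intro!: add_nonneg_nonneg)
  then show ?thesis using r(1) by - (rule span_tight_quotient[of r], simp_all add: point_scaleR)
qed

text \<open>With all centers open the demand of \<open>i\<close> is exhausted. Closing a center of
  \<open>J\<close> other than the best one for \<open>i\<close> leaves \<open>i\<close> with
  unserved demand, and \<open>j\<close> is idle.\<close>

lemma e_x_outside_J:
  assumes "i \<in> I" "j \<notin> J" "0 < c j" "0 < max_over J (d i)"
  shows "e_x i j \<in> span tight"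
proof -
  obtain j0 where j0: "j0 \<in> J" "j0 \<noteq> best_open i" by (rule obtain_other)
  have "max_over J (d i) \<le> max_over (J - {j0}) (d i)"
    using best_open[of i] assms(1) j0 max_over_UNIV[of i] max_over_ge[of "best_open i" "J - {j0}" "d i"]
    by auto
  with assms(4) have M: "0 < max_over (J - {j0}) (d i)" by simp
  define r where "r = min (c j) ((1 - load j0) * max_over (J - {j0}) (d i))"
  have r: "0 < r" "r \<le> c j" "r \<le> (1 - load j0) * max_over (J - {j0}) (d i)"
    using assms M load_bounds[OF j0(1)] by (auto simp: r_def)
  have "point (\<lambda>i' j'. r * unit2 i j i' j') (\<lambda>_. 0) (\<lambda>_ _. 0) \<in> span tight"
    using r assms closed_plan_nonneg[OF j0(1)] c_nonneg max_demand_nonneg load_bounds[OF j0(1)]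
    by (intro closed_perturbation[OF j0(1)])
      (auto simp: sum_unit2_row sum_unit2_column unit_def unit2_def[abs_def] simp flip: sum_distrib_left
        intro!: add_nonneg_nonneg)
  then show ?thesis using r(1) by - (rule span_tight_quotient[of r], simp_all add: point_scaleR)
qed

section \<open>Exchanges of shipments inside \<open>I\<close> and \<open>J\<close>\<close>

text \<open>With all centers open, part of the shipment to \<open>i\<close> moves from
  \<open>j'\<close> to \<open>j\<close>, which has spare capacity; the total received by
  \<open>i\<close> is unchanged.\<close>

lemma e_x_exchange_J:
  assumes "i \<in> I" "0 < max_over J (d i)" "j \<in> J" "j' \<in> J"
  shows "e_x i j - e_x i j' \<in> span tight"
proof (cases "j = j'")
  case False
  define r where "r = min (c j * (1 - demand / capacity)) (open_plan i j')"
  have "0 < open_plan i j'"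
    using assms c_pos capacity_pos by (simp add: open_plan_def)
  then have r: "0 < r" "r \<le> c j * (1 - demand / capacity)" "r \<le> open_plan i j'"
    using assms spare_capacity[of j] c_pos[of j] by (auto simp: r_def)
  have "point (\<lambda>a b. r * (unit2 i j a b - unit2 i j' a b)) (\<lambda>_. 0) (\<lambda>_ _. 0) \<in> span tight"
  proof (rule open_perturbation)
    fix a b
    show "0 \<le> open_plan a b + r * (unit2 i j a b - unit2 i j' a b)"
      using r open_plan_nonneg[of a b] False by (auto simp: unit2_def unit_def)
    show "(\<Sum>a\<in>UNIV. r * (unit2 i j a b - unit2 i j' a b))
        \<le> (if b \<in> J then c b * (1 - demand / capacity) else c b)"
      using r spare_capacity[of b] c_nonneg[of b] assms False
      by (auto simp: sum_unit2_column sum_subtractf unit_def simp flip: sum_distrib_left)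
    show "(\<Sum>b\<in>UNIV. r * (unit2 i j a b - unit2 i j' a b))
        \<le> (if a \<in> I then 0 else max_over UNIV (d a))"
      using max_demand_nonneg
      by (auto simp: sum_unit2_row sum_subtractf simp flip: sum_distrib_left)
    show "(\<Sum>a\<in>I. \<Sum>b\<in>J. r * (unit2 i j a b - unit2 i j' a b)) = 0"
      using assms by (simp add: sum_unit2_row sum_subtractf flip: sum_distrib_left)
  qed
  then show ?thesis using r(1)
    by - (rule span_tight_quotient[of r], simp_all add: point_scaleR point_diff)
qed (simp add: span_zero)

text \<open>With \<open>j0\<close> closed, part of the output of \<open>j\<close> moves from
  \<open>i'\<close> to \<open>i\<close>, which has unserved demand; the total shipped by
  \<open>j\<close> is unchanged.\<close>

lemma e_x_exchange_I:
  assumes j: "j0 \<in> J" "j \<in> J" "j \<noteq> j0" and i: "i \<in> I" "i' \<in> I"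
    and M: "0 < max_over (J - {j0}) (d i)" "0 < max_over (J - {j0}) (d i')"
  shows "e_x i j - e_x i' j \<in> span tight"
proof (cases "i = i'")
  case False
  define r where "r = min ((1 - load j0) * max_over (J - {j0}) (d i)) (closed_plan j0 i' j)"
  have "0 < closed_plan j0 i' j"
    using assms c_pos demand_without_pos by (simp add: closed_plan_def)
  then have r: "0 < r" "r \<le> (1 - load j0) * max_over (J - {j0}) (d i)" "r \<le> closed_plan j0 i' j"
    using assms load_bounds[OF j(1)] by (auto simp: r_def)
  have "point (\<lambda>a b. r * (unit2 i j a b - unit2 i' j a b)) (\<lambda>_. 0) (\<lambda>_ _. 0) \<in> span tight"
  proof (rule closed_perturbation[OF j(1)])
    fix a b
    show "0 \<le> closed_plan j0 a b + r * (unit2 i j a b - unit2 i' j a b)"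
      using r closed_plan_nonneg[OF j(1), of a b] False by (auto simp: unit2_def unit_def)
    show "(\<Sum>a\<in>UNIV. r * (unit2 i j a b - unit2 i' j a b)) \<le> (if b \<in> J then 0 else c b)"
      using c_nonneg[of b]
      by (auto simp: sum_unit2_column sum_subtractf unit_def simp flip: sum_distrib_left)
    have "0 \<le> (1 - load j0) * max_over (J - {j0}) (d a)"
      using load_bounds[OF j(1)] max_demand_nonneg by simp
    then show "(\<Sum>b\<in>UNIV. r * (unit2 i j a b - unit2 i' j a b))
        \<le> (if a \<in> I then (1 - load j0) * max_over (J - {j0}) (d a) else 0)"
      using r i False
      by (auto simp: sum_unit2_row sum_subtractf unit_def simp flip: sum_distrib_left)
    show "(\<Sum>a\<in>I. \<Sum>b\<in>J. r * (unit2 i j a b - unit2 i' j a b)) = 0"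
      using i by (simp add: sum_unit2_row sum_subtractf sum_unit flip: sum_distrib_left sum_distrib_right)
  qed
  then show ?thesis using r(1)
    by - (rule span_tight_quotient[of r], simp_all add: point_scaleR point_diff)
qed (simp add: span_zero)

text \<open>Otherwise each customer in \<open>I\<close> loses all its demand for some closed center,
  so its demands summed over \<open>j0\<close> are at most \<open>card J - 1\<close> times its
  maximum. Summing over \<open>I\<close> bounds the total by \<open>(card J - 1) * capacity\<close>,
  against the sum of the shortage inequalities.\<close>

lemma hub_exists: "\<exists>i\<in>I. \<forall>j0\<in>J. 0 < max_over (J - {j0}) (d i)"
proof (rule ccontr)
  assume no_hub: "\<not> ?thesis"
  have "(\<Sum>j0\<in>J. max_over (J - {j0}) (d i)) \<le> (real (card J) - 1) * max_over J (d i)"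
    if i: "i \<in> I" for i
  proof -
    obtain j1 where j1: "j1 \<in> J" "max_over (J - {j1}) (d i) \<le> 0"
      using no_hub i by (auto simp: not_less)
    have "(\<Sum>j0\<in>J. max_over (J - {j0}) (d i)) \<le> (\<Sum>j0\<in>J. (1 - unit j1 j0) * max_over J (d i))"
      using j1 by (intro sum_mono) (auto simp: unit_def intro!: max_over_mono d_nonneg)
    also have "\<dots> = (real (card J) - 1) * max_over J (d i)"
      using j1 by (simp add: sum_subtractf sum_unit flip: sum_distrib_right)
    finally show ?thesis .
  qed
  then have "(\<Sum>i\<in>I. \<Sum>j0\<in>J. max_over (J - {j0}) (d i)) \<le> (real (card J) - 1) * demand"
    unfolding demand_def sum_distrib_left by (rule sum_mono)
  also have "\<dots> \<le> (real (card J) - 1) * capacity"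
    using demand_less card_J by (intro mult_left_mono) auto
  also have "\<dots> = (\<Sum>j0\<in>J. capacity - c j0)"
    by (simp add: sum_subtractf left_diff_distrib flip: capacity_def)
  also have "\<dots> < (\<Sum>j0\<in>J. demand_without j0)"
    using J_nonempty capacity_less_demand_without by (intro sum_strict_mono) auto
  finally show False
    unfolding demand_without_def by (subst (asm) sum.swap) simp
qed

text \<open>With a hub \<open>h\<close>, a fixed \<open>k\<close> in \<open>J\<close> and the best
  center \<open>b\<close> of \<open>i\<close>, the chain runs from \<open>(i, j)\<close> over
  \<open>(i, b)\<close> and \<open>(h, b)\<close> to \<open>(h, k)\<close>. The middle link closes a
  center other than \<open>b\<close>, so \<open>i\<close> keeps its maximal demand and
  \<open>h\<close> keeps a positive one.\<close>

lemma e_x_equivalent: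
  obtains v where
    "\<And>i j. i \<in> I \<Longrightarrow> 0 < max_over J (d i) \<Longrightarrow> j \<in> J \<Longrightarrow> e_x i j - v \<in> span tight"
proof -
  obtain h where h: "h \<in> I" "\<And>j0. j0 \<in> J \<Longrightarrow> 0 < max_over (J - {j0}) (d h)"
    using hub_exists by blast
  obtain k where k: "k \<in> J" using J_nonempty by blast
  have h_pos: "0 < max_over J (d h)"
    using h(2)[OF k] max_over_mono[of "J - {k}" J "d h"] d_nonneg by fastforce
  show thesis
  proof (rule that[of "e_x h k"])
    fix i j assume i: "i \<in> I" "0 < max_over J (d i)" and j: "j \<in> J"
    define b where "b = best_open i"
    have b: "b \<in> J" "d i b = max_over J (d i)"
      using best_open[of i] i max_over_UNIV by (auto simp: b_def)
    obtain j0 where j0: "j0 \<in> J" "j0 \<noteq> b" by (rule obtain_other)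
    have "0 < max_over (J - {j0}) (d i)"
      using b i(2) j0 max_over_ge[of b "J - {j0}" "d i"] by simp
    then have "e_x i b - e_x h b \<in> span tight"
      using j0 b i h by (intro e_x_exchange_I[of j0]) auto
    moreover have "e_x i j - e_x i b \<in> span tight" using i j b by (intro e_x_exchange_J)
    moreover have "e_x h b - e_x h k \<in> span tight" using h h_pos k b by (intro e_x_exchange_J)
    ultimately have "(e_x i j - e_x i b) + (e_x i b - e_x h b) + (e_x h b - e_x h k) \<in> span tight"
      by (intro span_add)
    then show "e_x i j - e_x h k \<in> span tight" by simp
  qed
qed

section \<open>The unit vectors inside \<open>I\<close> and \<open>J\<close>\<close>

lemma e_x_e_y_inside:
  shows "\<And>i j. i \<in> I \<Longrightarrow> 0 < max_over J (d i) \<Longrightarrow> j \<in> J \<Longrightarrow> e_x i j \<in> span tight"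
    and "\<And>j. j \<in> J \<Longrightarrow> e_y j \<in> span tight"
proof -
  obtain v where v:
    "\<And>i j. i \<in> I \<Longrightarrow> 0 < max_over J (d i) \<Longrightarrow> j \<in> J \<Longrightarrow> e_x i j - v \<in> span tight"
    by (rule e_x_equivalent) blast
  have q: "point (\<lambda>_ _. 0) (\<lambda>_. 0) Q \<in> span tight" for Q
    unfolding point_expand_q[of Q] by (intro span_sum span_scale e_q_mem)
  \<comment> \<open>Modulo the span the \<open>q\<close>-part vanishes and each shipped unit counts
    as \<open>v\<close>.\<close>
  have reduce: "(\<Sum>i\<in>I. \<Sum>j\<in>J. X i j) *\<^sub>R v + point (\<lambda>_ _. 0) Y (\<lambda>_ _. 0) \<in> span tight"
    if XYQ: "point X Y Q \<in> tight"
      and X: "\<And>i j. \<not> (i \<in> I \<and> j \<in> J \<and> 0 < max_over J (d i)) \<Longrightarrow> X i j = 0" for X Y Q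
  proof -
    have "(\<Sum>i\<in>I. \<Sum>j\<in>J. X i j) = (\<Sum>i\<in>UNIV. \<Sum>j\<in>UNIV. X i j)"
      by (intro sum.mono_neutral_cong_left ballI sum.mono_neutral_left sum.neutral) (auto intro: X)
    then have "point X (\<lambda>_. 0) (\<lambda>_ _. 0) - (\<Sum>i\<in>I. \<Sum>j\<in>J. X i j) *\<^sub>R v
        = (\<Sum>i\<in>UNIV. \<Sum>j\<in>UNIV. X i j *\<^sub>R (e_x i j - v))"
      unfolding point_expand_x[of X]
      by (simp add: scaleR_diff_right sum_subtractf scaleR_sum_left)
    moreover have "X i j *\<^sub>R (e_x i j - v) \<in> span tight" for i j
      using X[of i j] v[of i j] by (cases "X i j = 0") (auto intro: span_scale span_zero)
    ultimately have "point X (\<lambda>_. 0) (\<lambda>_ _. 0) - (\<Sum>i\<in>I. \<Sum>j\<in>J. X i j) *\<^sub>R v \<in> span tight"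
      by (simp add: span_sum)
    from span_diff[OF span_diff[OF span_base[OF XYQ] q[of Q]] this]
    show ?thesis by (subst (asm) point_split[of X Y Q]) (simp add: algebra_simps)
  qed
  have all_open: "demand *\<^sub>R v + point (\<lambda>_ _. 0) (\<lambda>_. 1) (\<lambda>_ _. 0) \<in> span tight"
  proof -
    have "point (\<lambda>i j. open_plan i j + 0) (\<lambda>_. 1) (\<lambda>i. unit (best_open i)) \<in> tight"
      using spare_capacity c_nonneg max_demand_nonneg open_plan_nonneg
      by (intro open_point) auto
    moreover have "open_plan i j = 0" if "\<not> (i \<in> I \<and> j \<in> J \<and> 0 < max_over J (d i))" for i j
      using that max_demand_nonneg[of J i] by (auto simp: open_plan_def)
    ultimately show ?thesis using reduce[of open_plan] by (simp add: open_plan_total)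
  qed
  have one_closed: "(capacity - c j) *\<^sub>R v + point (\<lambda>_ _. 0) (\<lambda>k. 1 - unit j k) (\<lambda>_ _. 0) \<in> span tight"
    if j: "j \<in> J" for j
  proof -
    have "point (\<lambda>i k. closed_plan j i k + 0) (\<lambda>k. 1 - unit j k) (\<lambda>i. unit (best_closed j i)) \<in> tight"
    proof (rule closed_point[OF j])
      fix i
      have "load j * max_over (J - {j}) (d i) \<le> max_over (J - {j}) (d i)"
        using load_bounds[OF j] max_demand_nonneg by (intro mult_left_le_one_le) auto
      then show "(\<Sum>k\<in>UNIV. closed_plan j i k) + (\<Sum>k\<in>(UNIV::'n set). 0)
          \<le> (\<Sum>k\<in>UNIV. d i k * unit (best_closed j i) k)"
        using max_demand_nonneg
        by (simp add: closed_plan_row[OF j] sum_mult_unit best_closed(2))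
      show "unit (best_closed j i) j = 0" using best_closed(1)[of j i] by (auto simp: unit_def)
    qed (use closed_plan_nonneg[OF j] c_nonneg in \<open>auto simp: sum_unit unit_def\<close>)
    moreover have "closed_plan j i k = 0" if "\<not> (i \<in> I \<and> k \<in> J \<and> 0 < max_over J (d i))" for i k
    proof -
      have "max_over (J - {j}) (d i) \<le> max_over J (d i)"
        by (intro max_over_mono d_nonneg) auto
      with that max_demand_nonneg[of "J - {j}" i] show ?thesis by (auto simp: closed_plan_def)
    qed
    ultimately show ?thesis
      using reduce[of "closed_plan j"] by (simp add: closed_plan_total[OF j])
  qed
  have step: "(demand - capacity + c j) *\<^sub>R v + e_y j \<in> span tight" if "j \<in> J" for j
  proof -
    have "(demand *\<^sub>R v + point (\<lambda>_ _. 0) (\<lambda>_. 1) (\<lambda>_ _. 0))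
        - ((capacity - c j) *\<^sub>R v + point (\<lambda>_ _. 0) (\<lambda>k. 1 - unit j k) (\<lambda>_ _. 0))
      = (demand - capacity + c j) *\<^sub>R v
        + (point (\<lambda>_ _. 0) (\<lambda>_. 1) (\<lambda>_ _. 0) - point (\<lambda>_ _. 0) (\<lambda>k. 1 - unit j k) (\<lambda>_ _. 0))"
      by (simp add: algebra_simps)
    then show ?thesis
      using span_diff[OF all_open one_closed[OF that]] by (simp add: point_diff)
  qed
  \<comment> \<open>Summing \<open>step\<close> over \<open>J\<close> and adding the unit vectors
    outside \<open>J\<close> reproduces the \<open>y\<close>-part of \<open>all_open\<close>;
    subtraction then leaves a multiple of \<open>v\<close>, whose factor is
    \<open>rhs\<close>.\<close>
  have "(\<Sum>j\<in>J. (demand - capacity + c j) *\<^sub>R v + e_y j) + (\<Sum>j\<in>-J. e_y j) \<in> span tight"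
    by (intro span_add span_sum step e_y_outside_J) auto
  moreover have "point (\<lambda>(_::'m) _. 0) (\<lambda>_. 1) (\<lambda>_ _. 0) = (\<Sum>j\<in>J. e_y j) + (\<Sum>j\<in>-J. e_y j)"
    unfolding point_expand_y[of "\<lambda>_. 1"]
    using sum.subset_diff[of J UNIV "\<lambda>j. e_y j"] by (simp add: Compl_eq_Diff_UNIV add.commute)
  moreover have "(\<Sum>j\<in>J. demand - capacity + c j) = real (card J) * (demand - capacity) + capacity"
    by (simp add: sum.distrib flip: capacity_def)
  ultimately have "(real (card J) * (demand - capacity) + capacity) *\<^sub>R v
      + point (\<lambda>_ _. 0) (\<lambda>_. 1) (\<lambda>_ _. 0) \<in> span tight"
    by (simp add: sum.distrib add.assoc flip: scaleR_sum_left)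
  from span_diff[OF all_open this]
  have "(demand - (real (card J) * (demand - capacity) + capacity)) *\<^sub>R v \<in> span tight"
    by (simp add: scaleR_diff_left)
  moreover have "demand - (real (card J) * (demand - capacity) + capacity) = rhs"
    by (simp add: rhs_eq algebra_simps)
  ultimately have v_mem: "v \<in> span tight"
    using rhs_pos by - (rule span_tight_quotient[of rhs], auto)
  show "e_x i j \<in> span tight" if "i \<in> I" "0 < max_over J (d i)" "j \<in> J" for i j
    using span_add[OF v[OF that] v_mem] by simp
  show "e_y j \<in> span tight" if "j \<in> J" for j
    using span_diff[OF step[OF that] span_scale[OF v_mem, of "demand - capacity + c j"]] by simp
qed

section \<open>Dimension of the face\<close>

text \<open>The hull need not be full-dimensional: \<open>x\<close> vanishes at
  \<open>(i, j)\<close> if \<open>c j = 0\<close> or \<open>i\<close> has no demand. A nonzero entry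
  forces both to be positive, which the lemmas on \<open>e_x\<close> require.\<close>

lemma chi_L_subset_span_tight: "chi_L c d \<subseteq> span tight"
proof
  fix z assume z_mem: "z \<in> chi_L c d"
  obtain X Y Q where z: "z = point X Y Q" by (rule point_cases)
  have col: "(\<Sum>i\<in>UNIV. X i j) \<le> c j * Y j" and row: "(\<Sum>j\<in>UNIV. X i j) \<le> (\<Sum>j\<in>UNIV. d i j * Q i j)"
    and X0: "X i j \<ge> 0" and Q0: "Q i j \<ge> 0" for i j
    using z_mem unfolding z point_mem_chi_L by auto
  have x: "X i j *\<^sub>R e_x i j \<in> span tight" for i j
  proof (cases "X i j = 0")
    case False
    with X0[of i j] have pos: "0 < X i j" by simp
    also have "X i j \<le> (\<Sum>i\<in>UNIV. X i j)" by (intro member_le_sum X0) auto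
    finally have c: "0 < c j" using col[of j] c_nonneg[of j] by (cases "c j = 0") auto
    have "X i j \<le> (\<Sum>j\<in>UNIV. X i j)" by (intro member_le_sum X0) auto
    also have "\<dots> \<le> (\<Sum>j\<in>UNIV. max_over UNIV (d i) * Q i j)"
      by (intro order_trans[OF row] sum_mono mult_right_mono Q0 max_over_ge) auto
    finally have "max_over UNIV (d i) \<noteq> 0" using pos by auto
    with max_demand_nonneg[of UNIV i] have d: "0 < max_over UNIV (d i)" by simp
    show ?thesis
      using c d max_over_UNIV[of i]
      by (intro span_scale, cases "i \<in> I"; cases "j \<in> J")
        (auto intro: e_x_outside_I e_x_outside_J e_x_e_y_inside)
  qed (simp add: span_zero)
  have y: "Y j *\<^sub>R e_y j \<in> span tight" for j
    using e_y_outside_J e_x_e_y_inside(2) by (intro span_scale) blast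
  have q: "Q i j *\<^sub>R e_q i j \<in> span tight" for i j
    by (intro span_scale e_q_mem)
  show "z \<in> span tight"
    unfolding z point_split[of X Y Q] point_expand_x[of X] point_expand_y[of Y] point_expand_q[of Q]
    by (intro span_add span_sum x y q)
qed

lemma facet: "defines_facet lhs rhs (convex hull (chi_L c d))"
  unfolding defines_facet_def
proof (intro conjI)
  let ?P = "convex hull (chi_L c d)"
  let ?F = "{z \<in> ?P. lhs z = rhs}"
  show "linear lhs" by (rule linear_lhs)
  have "convex {z. lhs z \<le> rhs}"
    using convex_linear_vimage[OF linear_lhs, of "{..rhs}"] by (simp add: vimage_def)
  then show "\<forall>z\<in>?P. lhs z \<le> rhs"
    using hull_minimal[of "chi_L c d" "{z. lhs z \<le> rhs}" convex] lhs_le_rhs by blast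
  have "point (\<lambda>_ _. 0) (\<lambda>_. 0) (\<lambda>_ _. 0) \<in> chi_L c d"
    by (simp add: point_mem_chi_L)
  then have "0 \<in> chi_L c d" by (simp only: point_zero)
  then have zero: "0 \<in> ?P" by (rule hull_inc)
  have "tight \<subseteq> ?F" by (auto simp: tight_def intro: hull_inc)
  then have "chi_L c d \<subseteq> span ?F"
    by (rule order_trans[OF chi_L_subset_span_tight span_mono])
  then have "?P \<subseteq> span ?F"
    by (intro hull_minimal subspace_imp_convex subspace_span)
  \<comment> \<open>Linear spanning becomes an affine statement once the origin is added.\<close>
  also have "span ?F = affine hull (insert 0 ?F)"
    using affine_hull_span_0[of "insert 0 ?F"] hull_inc[of 0 "insert 0 ?F" affine]
    by (simp add: span_insert_0)
  finally have "aff_dim ?P \<le> aff_dim (insert 0 ?F)"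
    using aff_dim_subset[of ?P "affine hull (insert 0 ?F)"] by (simp only: aff_dim_affine_hull)
  moreover have "insert 0 ?F \<subseteq> ?P" using zero by auto
  then have "aff_dim (insert 0 ?F) \<le> aff_dim ?P" by (rule aff_dim_subset)
  \<comment> \<open>On the affine hull of the face \<open>lhs\<close> is constantly the positive
    \<open>rhs\<close>, so adding the origin raises the dimension by exactly one.\<close>
  moreover have "0 \<notin> affine hull ?F"
  proof
    have "affine (lhs -` {rhs})"
      unfolding affine_def
      by (auto simp: linear_add[OF linear_lhs] linear_scale[OF linear_lhs] simp flip: distrib_right)
    then have "affine hull ?F \<subseteq> lhs -` {rhs}"
      by (intro hull_minimal) auto
    moreover assume "0 \<in> affine hull ?F"
    ultimately show False using rhs_pos linear_0[OF linear_lhs] by auto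
  qed
  then have "aff_dim (insert 0 ?F) = aff_dim ?F + 1" by (simp add: aff_dim_insert)
  ultimately show "aff_dim ?F = aff_dim ?P - 1" by simp
qed

end

theorem theorem3:
  fixes c :: "'n::finite \<Rightarrow> real"
    and d :: "'m::finite \<Rightarrow> 'n \<Rightarrow> real"
    and I :: "'m set" and J :: "'n set"
  assumes "\<And>j. c j \<ge> 0" and "\<And>i j. d i j \<ge> 0"
    and "(\<Sum>j\<in>J. c j) > (\<Sum>i\<in>I. max_over J (d i))"
    and "\<And>i. i \<in> I \<Longrightarrow> max_over UNIV (d i) = max_over J (d i)"
    and "\<And>j0. j0 \<in> J \<Longrightarrow>
           (\<Sum>j\<in>J - {j0}. c j) < (\<Sum>i\<in>I. max_over (J - {j0}) (d i))"
  shows "defines_facet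
           (\<lambda>(x :: real ^ 'n ^ 'm, y :: real ^ 'n, q :: real ^ 'n ^ 'm).
              (\<Sum>i\<in>I. \<Sum>j\<in>J. x $ i $ j) +
              (\<Sum>j\<in>J. ((\<Sum>j'\<in>J - {j}. c j') - (\<Sum>i\<in>I. max_over J (d i))) * y $ j))
           ((real (card J) - 1) * ((\<Sum>j\<in>J. c j) - (\<Sum>i\<in>I. max_over J (d i))))
           (convex hull (chi_L c d))"
proof -
  interpret service_network c d I J
    using assms by unfold_locales auto
  show ?thesis using facet unfolding lhs_def rhs_def .
qed

end
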